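(* Work in intuitionistic (higher-order) type theory, i.e. the internal logic of an elementary topos. Assume that whenever $A$ is a subset of a finite set and $f: A \to A+1$ is a function, there exists an element of $A+1$ not in the range of $f$. Then the law of the excluded middle holds: for every truth value (proposition) $u$, $u$ or not $u$.
   Context: Logic is intuitionistic. A set $S$ is finite (Kuratowski-finite) if it belongs to every family $\mathcal{Y}$ of sets that contains $\emptyset$ and satisfies: whenever $Z \in \mathcal{Y}$ and $a \in S$, then $Z \cup \{a\} \in \mathcal{Y}$. $A+1$ denotes the disjoint union (coproduct) of $A$ with a one-element set. *)

theory Defs
  imports Main
begin

text \<open>
  Isabelle/HOL is classical, so intuitionistic higher-order type theory is represented by its
  terms and its derivations. It is the type theory of Lambek and Scott (the internal language of
  an elementary topos), without a natural numbers type, and with binary sum types because the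
  coproducts of a topos are referred to. The parameter \<open>'b\<close> is a collection of base types and
  \<open>'c\<close> a collection of constants, so that the objects and the global elements of any given topos
  can be named.
\<close>

datatype 'b ty =
    Base 'b
  | One
  | Omega
  | Pow "'b ty"
  | Prd "'b ty" "'b ty"
  | Cop "'b ty" "'b ty"

text \<open>
  Variables are de Bruijn indices; \<open>Compr\<close>, \<open>Forall\<close> and \<open>Exists\<close> bind index 0 in their last
  argument. Formulas are the terms of type \<open>Omega\<close>. \<open>InL B t\<close> is the left injection into a sum
  whose right summand is \<open>B\<close>, and \<open>InR A t\<close> the right injection into a sum whose left summand
  is \<open>A\<close>.
\<close>

datatype ('b, 'c) tm =
    Var nat
  | Cst 'c
  | Star
  | Pr "('b, 'c) tm" "('b, 'c) tm"
  | InL "'b ty" "('b, 'c) tm"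
  | InR "'b ty" "('b, 'c) tm"
  | Compr "'b ty" "('b, 'c) tm"
  | Mem "('b, 'c) tm" "('b, 'c) tm"  (infix "\<^bold>\<in>" 50)
  | Equ "('b, 'c) tm" "('b, 'c) tm"  (infix "\<^bold>=" 50)
  | Tru
  | Fls
  | Conj "('b, 'c) tm" "('b, 'c) tm"  (infixr "\<^bold>\<and>" 35)
  | Disj "('b, 'c) tm" "('b, 'c) tm"  (infixr "\<^bold>\<or>" 30)
  | Impl "('b, 'c) tm" "('b, 'c) tm"  (infixr "\<^bold>\<longrightarrow>" 25)
  | Forall "'b ty" "('b, 'c) tm"
  | Exists "'b ty" "('b, 'c) tm"

primrec lift :: "nat \<Rightarrow> ('b, 'c) tm \<Rightarrow> ('b, 'c) tm" where
  "lift k (Var i) = Var (if i < k then i else Suc i)"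
| "lift k (Cst c) = Cst c"
| "lift k Star = Star"
| "lift k (Pr s t) = Pr (lift k s) (lift k t)"
| "lift k (InL B t) = InL B (lift k t)"
| "lift k (InR A t) = InR A (lift k t)"
| "lift k (Compr A p) = Compr A (lift (Suc k) p)"
| "lift k (s \<^bold>\<in> t) = (lift k s \<^bold>\<in> lift k t)"
| "lift k (s \<^bold>= t) = (lift k s \<^bold>= lift k t)"
| "lift k Tru = Tru"
| "lift k Fls = Fls"
| "lift k (p \<^bold>\<and> q) = (lift k p \<^bold>\<and> lift k q)"
| "lift k (p \<^bold>\<or> q) = (lift k p \<^bold>\<or> lift k q)"
| "lift k (p \<^bold>\<longrightarrow> q) = (lift k p \<^bold>\<longrightarrow> lift k q)"
| "lift k (Forall A p) = Forall A (lift (Suc k) p)"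
| "lift k (Exists A p) = Exists A (lift (Suc k) p)"

abbreviation up :: "('b, 'c) tm \<Rightarrow> ('b, 'c) tm"  ("\<up>_" [100] 100) where
  "\<up>t \<equiv> lift 0 t"

text \<open>\<open>subst k u t\<close> replaces index \<open>k\<close> in \<open>t\<close> by \<open>u\<close> and lowers the indices above \<open>k\<close>.\<close>

primrec subst :: "nat \<Rightarrow> ('b, 'c) tm \<Rightarrow> ('b, 'c) tm \<Rightarrow> ('b, 'c) tm" where
  "subst k u (Var i) = (if i < k then Var i else if i = k then u else Var (i - 1))"
| "subst k u (Cst c) = Cst c"
| "subst k u Star = Star"
| "subst k u (Pr s t) = Pr (subst k u s) (subst k u t)"
| "subst k u (InL B t) = InL B (subst k u t)"
| "subst k u (InR A t) = InR A (subst k u t)"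
| "subst k u (Compr A p) = Compr A (subst (Suc k) (\<up>u) p)"
| "subst k u (s \<^bold>\<in> t) = (subst k u s \<^bold>\<in> subst k u t)"
| "subst k u (s \<^bold>= t) = (subst k u s \<^bold>= subst k u t)"
| "subst k u Tru = Tru"
| "subst k u Fls = Fls"
| "subst k u (p \<^bold>\<and> q) = (subst k u p \<^bold>\<and> subst k u q)"
| "subst k u (p \<^bold>\<or> q) = (subst k u p \<^bold>\<or> subst k u q)"
| "subst k u (p \<^bold>\<longrightarrow> q) = (subst k u p \<^bold>\<longrightarrow> subst k u q)"
| "subst k u (Forall A p) = Forall A (subst (Suc k) (\<up>u) p)"
| "subst k u (Exists A p) = Exists A (subst (Suc k) (\<up>u) p)"

abbreviation Neg :: "('b, 'c) tm \<Rightarrow> ('b, 'c) tm"  ("\<^bold>\<not> _" [40] 40) where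
  "\<^bold>\<not> p \<equiv> p \<^bold>\<longrightarrow> Fls"

abbreviation Iff :: "('b, 'c) tm \<Rightarrow> ('b, 'c) tm \<Rightarrow> ('b, 'c) tm"  (infixr "\<^bold>\<longleftrightarrow>" 25) where
  "p \<^bold>\<longleftrightarrow> q \<equiv> (p \<^bold>\<longrightarrow> q) \<^bold>\<and> (q \<^bold>\<longrightarrow> p)"

text \<open>
  \<open>has_type \<Sigma> \<Delta> t A\<close>: the constants have the types given by \<open>\<Sigma>\<close>, and the free variable \<open>i\<close>
  has type \<open>\<Delta> ! i\<close>.
\<close>

inductive has_type :: "('c \<Rightarrow> 'b ty) \<Rightarrow> 'b ty list \<Rightarrow> ('b, 'c) tm \<Rightarrow> 'b ty \<Rightarrow> bool"
  for \<Sigma> :: "'c \<Rightarrow> 'b ty" where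
  ty_Var: "i < length \<Delta> \<Longrightarrow> has_type \<Sigma> \<Delta> (Var i) (\<Delta> ! i)"
| ty_Cst: "has_type \<Sigma> \<Delta> (Cst c) (\<Sigma> c)"
| ty_Star: "has_type \<Sigma> \<Delta> Star One"
| ty_Pr: "\<lbrakk>has_type \<Sigma> \<Delta> s A; has_type \<Sigma> \<Delta> t B\<rbrakk> \<Longrightarrow> has_type \<Sigma> \<Delta> (Pr s t) (Prd A B)"
| ty_InL: "has_type \<Sigma> \<Delta> t A \<Longrightarrow> has_type \<Sigma> \<Delta> (InL B t) (Cop A B)"
| ty_InR: "has_type \<Sigma> \<Delta> t B \<Longrightarrow> has_type \<Sigma> \<Delta> (InR A t) (Cop A B)"
| ty_Compr: "has_type \<Sigma> (A # \<Delta>) p Omega \<Longrightarrow> has_type \<Sigma> \<Delta> (Compr A p) (Pow A)"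
| ty_Mem: "\<lbrakk>has_type \<Sigma> \<Delta> s A; has_type \<Sigma> \<Delta> t (Pow A)\<rbrakk> \<Longrightarrow> has_type \<Sigma> \<Delta> (s \<^bold>\<in> t) Omega"
| ty_Equ: "\<lbrakk>has_type \<Sigma> \<Delta> s A; has_type \<Sigma> \<Delta> t A\<rbrakk> \<Longrightarrow> has_type \<Sigma> \<Delta> (s \<^bold>= t) Omega"
| ty_Tru: "has_type \<Sigma> \<Delta> Tru Omega"
| ty_Fls: "has_type \<Sigma> \<Delta> Fls Omega"
| ty_Conj: "\<lbrakk>has_type \<Sigma> \<Delta> p Omega; has_type \<Sigma> \<Delta> q Omega\<rbrakk> \<Longrightarrow> has_type \<Sigma> \<Delta> (p \<^bold>\<and> q) Omega"
| ty_Disj: "\<lbrakk>has_type \<Sigma> \<Delta> p Omega; has_type \<Sigma> \<Delta> q Omega\<rbrakk> \<Longrightarrow> has_type \<Sigma> \<Delta> (p \<^bold>\<or> q) Omega"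
| ty_Impl: "\<lbrakk>has_type \<Sigma> \<Delta> p Omega; has_type \<Sigma> \<Delta> q Omega\<rbrakk> \<Longrightarrow> has_type \<Sigma> \<Delta> (p \<^bold>\<longrightarrow> q) Omega"
| ty_Forall: "has_type \<Sigma> (A # \<Delta>) p Omega \<Longrightarrow> has_type \<Sigma> \<Delta> (Forall A p) Omega"
| ty_Exists: "has_type \<Sigma> (A # \<Delta>) p Omega \<Longrightarrow> has_type \<Sigma> \<Delta> (Exists A p) Omega"

text \<open>
  \<open>entails \<Sigma> \<Delta> \<Gamma> p\<close>: intuitionistic natural deduction of \<open>p\<close> from the set \<open>\<Gamma>\<close> of hypotheses,
  over the variables declared in \<open>\<Delta>\<close>. Keeping track of \<open>\<Delta>\<close> is essential because types may be
  empty. The set \<open>\<Gamma>\<close> may be infinite, so that it can also hold all the axioms of a theory.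
\<close>

inductive entails ::
    "('c \<Rightarrow> 'b ty) \<Rightarrow> 'b ty list \<Rightarrow> ('b, 'c) tm set \<Rightarrow> ('b, 'c) tm \<Rightarrow> bool"
  for \<Sigma> :: "'c \<Rightarrow> 'b ty" where
  hyp: "\<lbrakk>p \<in> \<Gamma>; has_type \<Sigma> \<Delta> p Omega\<rbrakk> \<Longrightarrow> entails \<Sigma> \<Delta> \<Gamma> p"
| TruI: "entails \<Sigma> \<Delta> \<Gamma> Tru"
| FlsE: "\<lbrakk>entails \<Sigma> \<Delta> \<Gamma> Fls; has_type \<Sigma> \<Delta> p Omega\<rbrakk> \<Longrightarrow> entails \<Sigma> \<Delta> \<Gamma> p"
| ConjI: "\<lbrakk>entails \<Sigma> \<Delta> \<Gamma> p; entails \<Sigma> \<Delta> \<Gamma> q\<rbrakk> \<Longrightarrow> entails \<Sigma> \<Delta> \<Gamma> (p \<^bold>\<and> q)"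
| ConjE1: "entails \<Sigma> \<Delta> \<Gamma> (p \<^bold>\<and> q) \<Longrightarrow> entails \<Sigma> \<Delta> \<Gamma> p"
| ConjE2: "entails \<Sigma> \<Delta> \<Gamma> (p \<^bold>\<and> q) \<Longrightarrow> entails \<Sigma> \<Delta> \<Gamma> q"
| DisjI1: "\<lbrakk>entails \<Sigma> \<Delta> \<Gamma> p; has_type \<Sigma> \<Delta> q Omega\<rbrakk> \<Longrightarrow> entails \<Sigma> \<Delta> \<Gamma> (p \<^bold>\<or> q)"
| DisjI2: "\<lbrakk>entails \<Sigma> \<Delta> \<Gamma> q; has_type \<Sigma> \<Delta> p Omega\<rbrakk> \<Longrightarrow> entails \<Sigma> \<Delta> \<Gamma> (p \<^bold>\<or> q)"
| DisjE: "\<lbrakk>entails \<Sigma> \<Delta> \<Gamma> (p \<^bold>\<or> q); entails \<Sigma> \<Delta> (insert p \<Gamma>) r; entails \<Sigma> \<Delta> (insert q \<Gamma>) r\<rbrakk>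
    \<Longrightarrow> entails \<Sigma> \<Delta> \<Gamma> r"
| ImplI: "\<lbrakk>has_type \<Sigma> \<Delta> p Omega; entails \<Sigma> \<Delta> (insert p \<Gamma>) q\<rbrakk> \<Longrightarrow> entails \<Sigma> \<Delta> \<Gamma> (p \<^bold>\<longrightarrow> q)"
| ImplE: "\<lbrakk>entails \<Sigma> \<Delta> \<Gamma> (p \<^bold>\<longrightarrow> q); entails \<Sigma> \<Delta> \<Gamma> p\<rbrakk> \<Longrightarrow> entails \<Sigma> \<Delta> \<Gamma> q"
| ForallI: "entails \<Sigma> (A # \<Delta>) (up ` \<Gamma>) p \<Longrightarrow> entails \<Sigma> \<Delta> \<Gamma> (Forall A p)"
| ForallE: "\<lbrakk>entails \<Sigma> \<Delta> \<Gamma> (Forall A p); has_type \<Sigma> \<Delta> t A\<rbrakk> \<Longrightarrow> entails \<Sigma> \<Delta> \<Gamma> (subst 0 t p)"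
| ExistsI: "\<lbrakk>has_type \<Sigma> (A # \<Delta>) p Omega; has_type \<Sigma> \<Delta> t A; entails \<Sigma> \<Delta> \<Gamma> (subst 0 t p)\<rbrakk>
    \<Longrightarrow> entails \<Sigma> \<Delta> \<Gamma> (Exists A p)"
| ExistsE: "\<lbrakk>entails \<Sigma> \<Delta> \<Gamma> (Exists A p); has_type \<Sigma> \<Delta> q Omega;
      entails \<Sigma> (A # \<Delta>) (insert p (up ` \<Gamma>)) (\<up>q)\<rbrakk>
    \<Longrightarrow> entails \<Sigma> \<Delta> \<Gamma> q"
| Equ_refl: "has_type \<Sigma> \<Delta> t A \<Longrightarrow> entails \<Sigma> \<Delta> \<Gamma> (t \<^bold>= t)"
| Equ_subst: "\<lbrakk>has_type \<Sigma> \<Delta> s A; has_type \<Sigma> \<Delta> t A; has_type \<Sigma> (A # \<Delta>) p Omega;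
      entails \<Sigma> \<Delta> \<Gamma> (s \<^bold>= t); entails \<Sigma> \<Delta> \<Gamma> (subst 0 s p)\<rbrakk>
    \<Longrightarrow> entails \<Sigma> \<Delta> \<Gamma> (subst 0 t p)"
| comprehension: "\<lbrakk>has_type \<Sigma> \<Delta> t A; has_type \<Sigma> (A # \<Delta>) p Omega\<rbrakk>
    \<Longrightarrow> entails \<Sigma> \<Delta> \<Gamma> (t \<^bold>\<in> Compr A p \<^bold>\<longleftrightarrow> subst 0 t p)"
| set_ext: "\<lbrakk>has_type \<Sigma> \<Delta> s (Pow A); has_type \<Sigma> \<Delta> t (Pow A);
      entails \<Sigma> \<Delta> \<Gamma> (Forall A (Var 0 \<^bold>\<in> \<up>s \<^bold>\<longleftrightarrow> Var 0 \<^bold>\<in> \<up>t))\<rbrakk>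
    \<Longrightarrow> entails \<Sigma> \<Delta> \<Gamma> (s \<^bold>= t)"
| prop_ext: "entails \<Sigma> \<Delta> \<Gamma> (p \<^bold>\<longleftrightarrow> q) \<Longrightarrow> entails \<Sigma> \<Delta> \<Gamma> (p \<^bold>= q)"
| One_eta: "has_type \<Sigma> \<Delta> t One \<Longrightarrow> entails \<Sigma> \<Delta> \<Gamma> (t \<^bold>= Star)"
| Pr_inj1: "entails \<Sigma> \<Delta> \<Gamma> (Pr s t \<^bold>= Pr s' t') \<Longrightarrow> entails \<Sigma> \<Delta> \<Gamma> (s \<^bold>= s')"
| Pr_inj2: "entails \<Sigma> \<Delta> \<Gamma> (Pr s t \<^bold>= Pr s' t') \<Longrightarrow> entails \<Sigma> \<Delta> \<Gamma> (t \<^bold>= t')"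
| Pr_surj: "has_type \<Sigma> \<Delta> t (Prd A B)
    \<Longrightarrow> entails \<Sigma> \<Delta> \<Gamma> (Exists A (Exists B (\<up>\<up>t \<^bold>= Pr (Var 1) (Var 0))))"
| InL_inj: "entails \<Sigma> \<Delta> \<Gamma> (InL B s \<^bold>= InL B t) \<Longrightarrow> entails \<Sigma> \<Delta> \<Gamma> (s \<^bold>= t)"
| InR_inj: "entails \<Sigma> \<Delta> \<Gamma> (InR A s \<^bold>= InR A t) \<Longrightarrow> entails \<Sigma> \<Delta> \<Gamma> (s \<^bold>= t)"
| InL_InR: "entails \<Sigma> \<Delta> \<Gamma> (InL B s \<^bold>= InR A t) \<Longrightarrow> entails \<Sigma> \<Delta> \<Gamma> Fls"
| Cop_cases: "has_type \<Sigma> \<Delta> t (Cop A B)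
    \<Longrightarrow> entails \<Sigma> \<Delta> \<Gamma>
          (Exists A (\<up>t \<^bold>= InL B (Var 0)) \<^bold>\<or> Exists B (\<up>t \<^bold>= InR A (Var 0)))"

text \<open>
  The sets of the type theory are the terms of the types \<open>Pow T\<close>. The following operations build
  terms from terms over the same variables, which are therefore lifted when they are placed under
  a binder.
\<close>

definition empty_set :: "'b ty \<Rightarrow> ('b, 'c) tm" where
  "empty_set T = Compr T Fls"

definition singleton :: "'b ty \<Rightarrow> ('b, 'c) tm \<Rightarrow> ('b, 'c) tm" where
  "singleton T a = Compr T (Var 0 \<^bold>= \<up>a)"

definition union :: "'b ty \<Rightarrow> ('b, 'c) tm \<Rightarrow> ('b, 'c) tm \<Rightarrow> ('b, 'c) tm" where
  "union T X Y = Compr T (Var 0 \<^bold>\<in> \<up>X \<^bold>\<or> Var 0 \<^bold>\<in> \<up>Y)"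

definition subset :: "'b ty \<Rightarrow> ('b, 'c) tm \<Rightarrow> ('b, 'c) tm \<Rightarrow> ('b, 'c) tm" where
  "subset T X Y = Forall T (Var 0 \<^bold>\<in> \<up>X \<^bold>\<longrightarrow> Var 0 \<^bold>\<in> \<up>Y)"

text \<open>Bound variables below: the family is outermost, then \<open>Z\<close>, then \<open>a\<close>.\<close>

definition kfinite :: "'b ty \<Rightarrow> ('b, 'c) tm \<Rightarrow> ('b, 'c) tm" where
  "kfinite T S =
     Forall (Pow (Pow T))
       (empty_set T \<^bold>\<in> Var 0 \<^bold>\<and>
        Forall (Pow T) (Forall T
          (Var 1 \<^bold>\<in> Var 2 \<^bold>\<and> Var 0 \<^bold>\<in> \<up>\<up>\<up>S
             \<^bold>\<longrightarrow> union T (Var 1) (singleton T (Var 0)) \<^bold>\<in> Var 2))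
        \<^bold>\<longrightarrow> \<up>S \<^bold>\<in> Var 0)"

text \<open>For \<open>A\<close> of type \<open>Pow T\<close>, the coproduct \<open>A + 1\<close> as a set of type \<open>Pow (Cop T One)\<close>.\<close>

definition plus_one :: "'b ty \<Rightarrow> ('b, 'c) tm \<Rightarrow> ('b, 'c) tm" where
  "plus_one T A =
     Compr (Cop T One)
       (Exists T (Var 0 \<^bold>\<in> \<up>\<up>A \<^bold>\<and> Var 1 \<^bold>= InL One (Var 0)) \<^bold>\<or> Var 0 \<^bold>= InR T Star)"

definition Exists1 :: "'b ty \<Rightarrow> ('b, 'c) tm \<Rightarrow> ('b, 'c) tm" where
  "Exists1 T p = Exists T (p \<^bold>\<and> Forall T (lift 1 p \<^bold>\<longrightarrow> Var 0 \<^bold>= Var 1))"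

text \<open>A function \<open>f\<close> from \<open>A\<close> to \<open>B\<close> is a functional graph, of type \<open>Pow (Prd T U)\<close>.\<close>

definition is_function ::
    "'b ty \<Rightarrow> 'b ty \<Rightarrow> ('b, 'c) tm \<Rightarrow> ('b, 'c) tm \<Rightarrow> ('b, 'c) tm \<Rightarrow> ('b, 'c) tm" where
  "is_function T U f A B =
     (Forall T (Forall U
        (Pr (Var 1) (Var 0) \<^bold>\<in> \<up>\<up>f \<^bold>\<longrightarrow> Var 1 \<^bold>\<in> \<up>\<up>A \<^bold>\<and> Var 0 \<^bold>\<in> \<up>\<up>B)) \<^bold>\<and>
      Forall T (Var 0 \<^bold>\<in> \<up>A \<^bold>\<longrightarrow> Exists1 U (Pr (Var 1) (Var 0) \<^bold>\<in> \<up>\<up>f)))"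

definition range_of :: "'b ty \<Rightarrow> 'b ty \<Rightarrow> ('b, 'c) tm \<Rightarrow> ('b, 'c) tm" where
  "range_of T U f = Compr U (Exists T (Pr (Var 0) (Var 1) \<^bold>\<in> \<up>\<up>f))"

text \<open>
  For all \<open>A\<close> of type \<open>Pow T\<close>: if \<open>A\<close> is included in some finite \<open>S\<close>, then for every function
  \<open>f\<close> from \<open>A\<close> to \<open>A + 1\<close> there is a \<open>z\<close> in \<open>A + 1\<close> outside the range of \<open>f\<close>. The binders
  are nested in the order \<open>A\<close>, \<open>S\<close> (in the premise only), \<open>f\<close>, \<open>z\<close>.
\<close>

definition no_surjection :: "'b ty \<Rightarrow> ('b, 'c) tm" where
  "no_surjection T =
     Forall (Pow T)
       (Exists (Pow T) (kfinite T (Var 0) \<^bold>\<and> subset T (Var 1) (Var 0)) \<^bold>\<longrightarrow>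
        Forall (Pow (Prd T (Cop T One)))
          (is_function T (Cop T One) (Var 0) (Var 1) (plus_one T (Var 1)) \<^bold>\<longrightarrow>
           Exists (Cop T One)
             (Var 0 \<^bold>\<in> plus_one T (Var 2) \<^bold>\<and>
              \<^bold>\<not> (Var 0 \<^bold>\<in> range_of T (Cop T One) (Var 1)))))"

definition excluded_middle :: "('b, 'c) tm" where
  "excluded_middle = Forall Omega (Var 0 \<^bold>\<or> \<^bold>\<not> Var 0)"

lemma ty_Var_eq:
  assumes "i < length \<Delta>" and "\<Delta> ! i = A"
  shows "has_type \<Sigma> \<Delta> (Var i) A"
  using ty_Var[OF assms(1)] assms(2) by simp

lemma no_surjection_type: "has_type \<Sigma> \<Delta> (no_surjection T) Omega"
  unfolding no_surjection_def kfinite_def subset_def is_function_def plus_one_def range_of_def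
    Exists1_def union_def singleton_def empty_set_def
  by simp (rule has_type.intros(2-) | (rule ty_Var_eq, (simp; fail), (simp; fail)))+

lemma excluded_middle_type: "has_type \<Sigma> \<Delta> excluded_middle Omega"
  unfolding excluded_middle_def
  by (rule has_type.intros(2-) | (rule ty_Var_eq, (simp; fail), (simp; fail)))+

end

theory Submission
  imports Defs
begin

text \<open>
  Given a truth value \<open>u\<close>, the subset \<open>A = {x \<in> 1 | u}\<close> of the finite set \<open>1\<close> has a function to
  \<open>A + 1\<close> that sends every element of \<open>A\<close> to the added point. An element of \<open>A + 1\<close> outside the
  range of this function either comes from \<open>A\<close>, and then \<open>u\<close> holds, or is the added point, and
  then \<open>A\<close> is empty, so \<open>u\<close> fails.
\<close>

\<comment> \<open>Each term constructor has exactly one typing rule, so these equivalences let the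
  simplifier compute typing side conditions.\<close>
inductive_simps has_type_iff [simp]:
  "has_type \<Sigma> \<Delta> (Var i) C"
  "has_type \<Sigma> \<Delta> (Cst c) C"
  "has_type \<Sigma> \<Delta> Star C"
  "has_type \<Sigma> \<Delta> (Pr s t) C"
  "has_type \<Sigma> \<Delta> (InL B t) C"
  "has_type \<Sigma> \<Delta> (InR A t) C"
  "has_type \<Sigma> \<Delta> (Compr A p) C"
  "has_type \<Sigma> \<Delta> (s \<^bold>\<in> t) C"
  "has_type \<Sigma> \<Delta> (s \<^bold>= t) C"
  "has_type \<Sigma> \<Delta> Tru C"
  "has_type \<Sigma> \<Delta> Fls C"
  "has_type \<Sigma> \<Delta> (p \<^bold>\<and> q) C"
  "has_type \<Sigma> \<Delta> (p \<^bold>\<or> q) C"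
  "has_type \<Sigma> \<Delta> (p \<^bold>\<longrightarrow> q) C"
  "has_type \<Sigma> \<Delta> (Forall A p) C"
  "has_type \<Sigma> \<Delta> (Exists A p) C"

lemma ComprI:
  assumes "has_type \<Sigma> \<Delta> t A" "has_type \<Sigma> (A # \<Delta>) p Omega" "entails \<Sigma> \<Delta> \<Gamma> (subst 0 t p)"
  shows "entails \<Sigma> \<Delta> \<Gamma> (t \<^bold>\<in> Compr A p)"
  using ImplE[OF ConjE2[OF comprehension[OF assms(1,2)]] assms(3)] .

lemma ComprD:
  assumes "entails \<Sigma> \<Delta> \<Gamma> (t \<^bold>\<in> Compr A p)" "has_type \<Sigma> \<Delta> t A" "has_type \<Sigma> (A # \<Delta>) p Omega"
  shows "entails \<Sigma> \<Delta> \<Gamma> (subst 0 t p)"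
  using ImplE[OF ConjE1[OF comprehension[OF assms(2,3)]] assms(1)] .

lemma subst_lift [simp]: "subst k u (lift k t) = t"
  by (induction t arbitrary: k u) auto

text \<open>Splitting the context at the cutoff lets the induction pass binders: a binder extends
  \<open>\<Delta>\<close> and raises the cutoff \<open>length \<Delta>\<close> with it.\<close>

lemma has_type_lift:
  assumes "has_type \<Sigma> (\<Delta> @ \<Delta>') t A"
  shows "has_type \<Sigma> (\<Delta> @ B # \<Delta>') (lift (length \<Delta>) t) A"
  using assms
proof (induction t arbitrary: \<Delta> A)
  case (Compr C p)
  then show ?case using Compr.IH[of "C # \<Delta>"] by simp
next
  case (Forall C p)
  then show ?case using Forall.IH[of "C # \<Delta>"] by simp
next
  case (Exists C p)
  then show ?case using Exists.IH[of "C # \<Delta>"] by simp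
qed (fastforce simp: nth_append Suc_diff_le)+

lemma has_type_up:
  "has_type \<Sigma> \<Delta> t A \<Longrightarrow> has_type \<Sigma> (B # \<Delta>) (\<up>t) A"
  using has_type_lift[of \<Sigma> "[]"] by simp

text \<open>Starting from reflexivity, two uses of \<open>Equ_subst\<close> rewrite the right-hand
  pair one component at a time.\<close>

lemma Pr_cong:
  assumes "entails \<Sigma> \<Delta> \<Gamma> (s \<^bold>= s')" "entails \<Sigma> \<Delta> \<Gamma> (t \<^bold>= t')"
    "has_type \<Sigma> \<Delta> s A" "has_type \<Sigma> \<Delta> s' A" "has_type \<Sigma> \<Delta> t B" "has_type \<Sigma> \<Delta> t' B"
  shows "entails \<Sigma> \<Delta> \<Gamma> (Pr s t \<^bold>= Pr s' t')"
proof -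
  \<comment> \<open>Sides of the two equations given to \<open>Equ_subst\<close>;
    \<open>Var 0\<close> marks the component to be replaced.\<close>
  have up: "has_type \<Sigma> (C # \<Delta>) (Pr (\<up>s) (\<up>t)) (Prd A B)"
    "has_type \<Sigma> (A # \<Delta>) (Pr (Var 0) (\<up>t)) (Prd A B)"
    "has_type \<Sigma> (B # \<Delta>) (Pr (\<up>s') (Var 0)) (Prd A B)" for C
    using assms by (simp_all add: has_type_up)
  have "entails \<Sigma> \<Delta> \<Gamma> (Pr s t \<^bold>= Pr s t)"
    using assms by (intro Equ_refl[where A = "Prd A B"]) simp
  then have "entails \<Sigma> \<Delta> \<Gamma> (Pr s t \<^bold>= Pr s' t)"
    using Equ_subst[OF assms(3,4) ty_Equ[OF up(1,2)] assms(1)] by simp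
  then show ?thesis
    using Equ_subst[OF assms(5,6) ty_Equ[OF up(1,3)] assms(2)] by simp
qed

text \<open>Written as the empty set with one point adjoined, the exact form that one step of the
  closure condition in \<open>kfinite\<close> produces.\<close>

abbreviation unit_set :: "('b, 'c) tm" where
  "unit_set \<equiv> union One (empty_set One) (singleton One Star)"

text \<open>The subset of 1 cut out by the truth value in variable \<open>i\<close>, which becomes
  \<open>Suc i\<close> under the binder. Lifting by \<open>up\<close> just raises \<open>i\<close>
  by one, whence the offsets \<open>i + 1\<close> and \<open>i + 2\<close> below.\<close>

abbreviation truth_set :: "nat \<Rightarrow> ('b, 'c) tm" where
  "truth_set i \<equiv> Compr One (Var (Suc i))"

text \<open>The graph of the map from \<open>truth_set i\<close> to the added point: a single pair,
  present exactly when variable \<open>i\<close> holds.\<close>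

abbreviation to_point :: "nat \<Rightarrow> ('b, 'c) tm" where
  "to_point i \<equiv>
     Compr (Prd One (Cop One One)) (Var (Suc i) \<^bold>\<and> Var 0 \<^bold>= Pr Star (InR One Star))"

lemmas set_defs = union_def empty_set_def singleton_def subset_def plus_one_def range_of_def

lemma in_unit_set:
  assumes "has_type \<Sigma> \<Delta> t One"
  shows "entails \<Sigma> \<Delta> \<Gamma> (t \<^bold>\<in> unit_set)"
  unfolding set_defs
  by (rule ComprI) (auto intro!: assms DisjI2 ComprI One_eta)

text \<open>A single closure step, with \<open>Z\<close> empty and \<open>a\<close> equal to
  \<open>Star\<close>, leads from the empty set to \<open>unit_set\<close>.\<close>

lemma kfinite_unit_set: "entails \<Sigma> \<Delta> \<Gamma> (kfinite One unit_set)"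
proof -
  let ?\<Delta> = "Pow (Pow One) # \<Delta>"
  let ?step = "Forall (Pow One) (Forall One
    (Var 1 \<^bold>\<in> Var 2 \<^bold>\<and> Var 0 \<^bold>\<in> unit_set
      \<^bold>\<longrightarrow> union One (Var 1) (singleton One (Var 0)) \<^bold>\<in> Var 2))"
  let ?p = "empty_set One \<^bold>\<in> Var 0 \<^bold>\<and> ?step"
  \<comment> \<open>\<open>\<Gamma>'\<close> is arbitrary so that it matches the hypotheses as
    lifted by \<open>ForallI\<close>; the same device recurs below.\<close>
  have "entails \<Sigma> ?\<Delta> (insert ?p \<Gamma>') (unit_set \<^bold>\<in> Var 0)" for \<Gamma>'
  proof -
    let ?\<Gamma> = "insert ?p \<Gamma>'"
    have p: "entails \<Sigma> ?\<Delta> ?\<Gamma> ?p"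
      by (rule hyp) (simp_all add: set_defs)
    have "entails \<Sigma> ?\<Delta> ?\<Gamma> (Forall One
        (empty_set One \<^bold>\<in> Var 1 \<^bold>\<and> Var 0 \<^bold>\<in> unit_set
          \<^bold>\<longrightarrow> union One (empty_set One) (singleton One (Var 0)) \<^bold>\<in> Var 1))"
      using ForallE[OF ConjE2[OF p], of "empty_set One"] by (simp add: set_defs)
    from ForallE[OF this, of Star]
    have "entails \<Sigma> ?\<Delta> ?\<Gamma>
        (empty_set One \<^bold>\<in> Var 0 \<^bold>\<and> Star \<^bold>\<in> unit_set \<^bold>\<longrightarrow> unit_set \<^bold>\<in> Var 0)"
      by (simp add: set_defs)
    then show ?thesis
      by (rule ImplE) (intro ConjI ConjE1[OF p] in_unit_set, simp)
  qed
  then have "entails \<Sigma> \<Delta> \<Gamma> (Forall (Pow (Pow One)) (?p \<^bold>\<longrightarrow> unit_set \<^bold>\<in> Var 0))"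
    by (intro ForallI ImplI) (simp_all add: set_defs)
  then show ?thesis
    by (simp add: kfinite_def set_defs)
qed

text \<open>This is the premise of \<open>no_surjection One\<close> at \<open>truth_set i\<close>.
  The witness is \<open>unit_set\<close>, which contains every term of type
  \<open>One\<close>.\<close>

lemma truth_set_subfinite:
  assumes "i < length \<Delta>" "\<Delta> ! i = Omega"
  shows "entails \<Sigma> \<Delta> \<Gamma>
    (Exists (Pow One) (kfinite One (Var 0) \<^bold>\<and> subset One (truth_set (Suc i)) (Var 0)))"
proof (rule ExistsI)
  have "entails \<Sigma> \<Delta> \<Gamma> (Forall One (Var 0 \<^bold>\<in> truth_set (Suc i) \<^bold>\<longrightarrow> Var 0 \<^bold>\<in> unit_set))"
    using assms by (auto intro!: ForallI ImplI in_unit_set)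
  then have "entails \<Sigma> \<Delta> \<Gamma> (subset One (truth_set i) unit_set)"
    by (simp add: set_defs)
  with kfinite_unit_set
  have "entails \<Sigma> \<Delta> \<Gamma> (kfinite One unit_set \<^bold>\<and> subset One (truth_set i) unit_set)"
    by (rule ConjI)
  \<comment> \<open>Stating this goal fixes the witness that \<open>ExistsI\<close> left
    open.\<close>
  then show "entails \<Sigma> \<Delta> \<Gamma>
      (subst 0 unit_set (kfinite One (Var 0) \<^bold>\<and> subset One (truth_set (Suc i)) (Var 0)))"
    by (simp add: set_defs kfinite_def)
qed (use assms in \<open>simp_all add: set_defs kfinite_def\<close>)

text \<open>Components need only be provably equal to \<open>Star\<close> and to the added point, so
  that variables are allowed in either place.\<close>

lemma to_pointI:
  assumes "entails \<Sigma> \<Delta> \<Gamma> (Var i)" "entails \<Sigma> \<Delta> \<Gamma> (s \<^bold>= Star)" "entails \<Sigma> \<Delta> \<Gamma> (t \<^bold>= InR One Star)"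
    "i < length \<Delta>" "\<Delta> ! i = Omega" "has_type \<Sigma> \<Delta> s One" "has_type \<Sigma> \<Delta> t (Cop One One)"
  shows "entails \<Sigma> \<Delta> \<Gamma> (Pr s t \<^bold>\<in> to_point i)"
  using assms by (intro ComprI) (auto intro!: ConjI Pr_cong[where A = One and B = "Cop One One"])

text \<open>The first conclusion puts arguments into \<open>truth_set i\<close>; the second puts
  values into \<open>plus_one\<close> and makes them unique.\<close>

lemma to_pointD:
  assumes "entails \<Sigma> \<Delta> \<Gamma> (Pr s t \<^bold>\<in> to_point i)"
    "i < length \<Delta>" "\<Delta> ! i = Omega" "has_type \<Sigma> \<Delta> s One" "has_type \<Sigma> \<Delta> t (Cop One One)"
  shows "entails \<Sigma> \<Delta> \<Gamma> (Var i)" "entails \<Sigma> \<Delta> \<Gamma> (t \<^bold>= InR One Star)"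
proof -
  have *: "entails \<Sigma> \<Delta> \<Gamma> (Var i \<^bold>\<and> Pr s t \<^bold>= Pr Star (InR One Star))"
    using ComprD[OF assms(1)] assms(2-) by simp
  show "entails \<Sigma> \<Delta> \<Gamma> (Var i)"
    using * by (rule ConjE1)
  show "entails \<Sigma> \<Delta> \<Gamma> (t \<^bold>= InR One Star)"
    using * by (intro Pr_inj2[OF ConjE2])
qed

lemma to_point_is_function:
  assumes i: "i < length \<Delta>" "\<Delta> ! i = Omega"
  shows "entails \<Sigma> \<Delta> \<Gamma>
    (is_function One (Cop One One) (to_point i) (truth_set i) (plus_one One (truth_set i)))"
proof -
  let ?U = "Cop One One"
  \<comment> \<open>The graph lies in the product of domain and codomain: the value is the added
    point, so the right disjunct of \<open>plus_one\<close> applies.\<close>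
  have "entails \<Sigma> (?U # One # \<Delta>) (insert (Pr (Var 1) (Var 0) \<^bold>\<in> to_point (i + 2)) \<Gamma>')
      (Var 1 \<^bold>\<in> truth_set (i + 2) \<^bold>\<and> Var 0 \<^bold>\<in> plus_one One (truth_set (i + 2)))"
    (is "entails _ ?\<Delta> ?\<Gamma> _") for \<Gamma>'
  proof -
    have "entails \<Sigma> ?\<Delta> ?\<Gamma> (Pr (Var 1) (Var 0) \<^bold>\<in> to_point (i + 2))"
      by (rule hyp) (use i in simp_all)
    note * = to_pointD[OF this]
    show ?thesis
      using i * by (intro ConjI) (auto simp: set_defs intro!: ComprI DisjI2)
  qed
  then have 1: "entails \<Sigma> \<Delta> \<Gamma> (Forall One (Forall ?U
      (Pr (Var 1) (Var 0) \<^bold>\<in> to_point (i + 2)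
        \<^bold>\<longrightarrow> Var 1 \<^bold>\<in> truth_set (i + 2) \<^bold>\<and> Var 0 \<^bold>\<in> plus_one One (truth_set (i + 2)))))"
    using i by (intro ForallI ImplI) simp_all
  \<comment> \<open>Each argument has a unique value: membership in the truth set returns the truth
    value itself, which puts the pair with the added point into the graph.\<close>
  have "entails \<Sigma> (One # \<Delta>) (insert (Var 0 \<^bold>\<in> truth_set (i + 1)) \<Gamma>')
      (Exists1 ?U (Pr (Var 1) (Var 0) \<^bold>\<in> to_point (i + 2)))"
    (is "entails _ ?\<Delta> ?\<Gamma> _") for \<Gamma>'
  proof -
    have "entails \<Sigma> ?\<Delta> ?\<Gamma> (Var 0 \<^bold>\<in> truth_set (i + 1))"
      by (rule hyp) (use i in simp_all)
    from ComprD[OF this] have "entails \<Sigma> ?\<Delta> ?\<Gamma> (Var (i + 1))"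
      using i by simp
    then have ex: "entails \<Sigma> ?\<Delta> ?\<Gamma> (Pr (Var 0) (InR One Star) \<^bold>\<in> to_point (i + 1))"
      using i by (intro to_pointI) (auto intro: One_eta Equ_refl[where A = ?U])
    \<comment> \<open>Uniqueness: any value in the graph equals the added point.\<close>
    have "entails \<Sigma> (?U # ?\<Delta>) (insert (Pr (Var 1) (Var 0) \<^bold>\<in> to_point (i + 2)) \<Gamma>'')
        (Var 0 \<^bold>= InR One Star)" (is "entails _ _ ?\<Gamma>' _") for \<Gamma>''
    proof -
      have "entails \<Sigma> (?U # ?\<Delta>) ?\<Gamma>' (Pr (Var 1) (Var 0) \<^bold>\<in> to_point (i + 2))"
        by (rule hyp) (use i in simp_all)
      from to_pointD(2)[OF this] show ?thesis
        using i by simp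
    qed
    then have "entails \<Sigma> ?\<Delta> ?\<Gamma>
        (Forall ?U (Pr (Var 1) (Var 0) \<^bold>\<in> to_point (i + 2) \<^bold>\<longrightarrow> Var 0 \<^bold>= InR One Star))"
      using i by (intro ForallI ImplI) simp_all
    with ex show ?thesis
      unfolding Exists1_def using i
      by (intro ExistsI[where t = "InR One Star"]) (simp_all add: ConjI)
  qed
  then have 2: "entails \<Sigma> \<Delta> \<Gamma> (Forall One
      (Var 0 \<^bold>\<in> truth_set (i + 1) \<^bold>\<longrightarrow> Exists1 ?U (Pr (Var 1) (Var 0) \<^bold>\<in> to_point (i + 2))))"
    using i by (intro ForallI ImplI) simp_all
  show ?thesis
    using ConjI[OF 1 2] by (simp add: is_function_def set_defs)
qed

lemma excluded_middle_Var:
  assumes ns: "entails \<Sigma> \<Delta> \<Gamma> (no_surjection One)" and i: "i < length \<Delta>" "\<Delta> ! i = Omega"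
  shows "entails \<Sigma> \<Delta> \<Gamma> (Var i \<^bold>\<or> \<^bold>\<not> Var i)"
proof -
  let ?U = "Cop One One"
  let ?ex = "\<lambda>f. Exists ?U (Var 0 \<^bold>\<in> plus_one One (truth_set (i + 2)) \<^bold>\<and>
    \<^bold>\<not> (Var 0 \<^bold>\<in> range_of One ?U f))"
  let ?q = "Var 0 \<^bold>\<in> plus_one One (truth_set (i + 1)) \<^bold>\<and>
    \<^bold>\<not> (Var 0 \<^bold>\<in> range_of One ?U (to_point (i + 1)))"
  \<comment> \<open>Instantiate \<open>A\<close> with \<open>truth_set i\<close>, then
    \<open>f\<close> with \<open>to_point i\<close>.\<close>
  have "entails \<Sigma> \<Delta> \<Gamma>
      (Exists (Pow One) (kfinite One (Var 0) \<^bold>\<and> subset One (truth_set (Suc i)) (Var 0)) \<^bold>\<longrightarrow>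
       Forall (Pow (Prd One ?U))
         (is_function One ?U (Var 0) (truth_set (i + 1)) (plus_one One (truth_set (i + 1))) \<^bold>\<longrightarrow>
          ?ex (Var 1)))"
    using ForallE[OF ns[unfolded no_surjection_def], of "truth_set i"] i
    by (simp add: set_defs is_function_def kfinite_def Exists1_def numeral_2_eq_2)
  from ForallE[OF ImplE[OF this truth_set_subfinite[OF i]], of "to_point i"]
  have "entails \<Sigma> \<Delta> \<Gamma>
      (is_function One ?U (to_point i) (truth_set i) (plus_one One (truth_set i))
        \<^bold>\<longrightarrow> Exists ?U ?q)"
    using i by (simp add: set_defs is_function_def Exists1_def numeral_2_eq_2)
  from this to_point_is_function[OF i] have "entails \<Sigma> \<Delta> \<Gamma> (Exists ?U ?q)"
    by (rule ImplE)
  \<comment> \<open>The point \<open>z\<close> outside the range is now \<open>Var 0\<close>, so the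
    truth value has moved to \<open>Suc i\<close>.\<close>
  moreover have "entails \<Sigma> (?U # \<Delta>) (insert ?q \<Gamma>') (Var (Suc i) \<^bold>\<or> \<^bold>\<not> Var (Suc i))"
    (is "entails _ ?\<Delta> ?\<Gamma> ?em") for \<Gamma>'
  proof -
    let ?left = "Exists One (Var 0 \<^bold>\<in> truth_set (i + 2) \<^bold>\<and> Var 1 \<^bold>= InL One (Var 0))"
    let ?right = "Var 0 \<^bold>= InR One Star"
    \<comment> \<open>The version with two extra hypotheses serves the refutation, which assumes
      both a disjunct and the truth value.\<close>
    have q: "entails \<Sigma> ?\<Delta> (insert r (insert p ?\<Gamma>)) ?q" "entails \<Sigma> ?\<Delta> ?\<Gamma> ?q" for p r
      by (rule hyp; use i in \<open>simp add: set_defs\<close>)+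
    have "entails \<Sigma> ?\<Delta> ?\<Gamma> (?left \<^bold>\<or> ?right)"
      using ComprD[OF ConjE1[OF q(2), unfolded plus_one_def]] i by (simp add: plus_one_def)
    \<comment> \<open>If \<open>z\<close> comes from an element of the truth set, that element
      witnesses the truth value.\<close>
    moreover have "entails \<Sigma> ?\<Delta> (insert ?left ?\<Gamma>) ?em"
    proof (rule ExistsE)
      show "entails \<Sigma> ?\<Delta> (insert ?left ?\<Gamma>) ?left"
        by (rule hyp) (use i in simp_all)
      let ?\<Gamma>' = "insert (Var 0 \<^bold>\<in> truth_set (i + 2) \<^bold>\<and> Var 1 \<^bold>= InL One (Var 0))
        (up ` insert ?left ?\<Gamma>)"
      have "entails \<Sigma> (One # ?\<Delta>) ?\<Gamma>' (Var 0 \<^bold>\<in> truth_set (i + 2))"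
        by (rule ConjE1, rule hyp, rule insertI1) (use i in simp)
      from ComprD[OF this] show "entails \<Sigma> (One # ?\<Delta>) ?\<Gamma>' (\<up>?em)"
        using i by (auto intro: DisjI1)
    qed (use i in simp)
    \<comment> \<open>If \<open>z\<close> is the added point, the truth value would make it the
      image of \<open>Star\<close>, contradicting that \<open>z\<close> is outside the
      range.\<close>
    moreover have "entails \<Sigma> ?\<Delta> (insert ?right ?\<Gamma>) ?em"
    proof (rule DisjI2, rule ImplI)
      let ?\<Gamma>' = "insert (Var (Suc i)) (insert ?right ?\<Gamma>)"
      have hyps: "entails \<Sigma> ?\<Delta> ?\<Gamma>' ?right" "entails \<Sigma> ?\<Delta> ?\<Gamma>' (Var (Suc i))"
        by (rule hyp; use i in simp)+
      have "entails \<Sigma> ?\<Delta> ?\<Gamma>' (Pr Star (Var 0) \<^bold>\<in> to_point (i + 1))"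
        using i hyps by (intro to_pointI) (auto intro: One_eta)
      then have "entails \<Sigma> ?\<Delta> ?\<Gamma>' (Var 0 \<^bold>\<in> range_of One ?U (to_point (i + 1)))"
        unfolding range_of_def using i
        by (intro ComprI) (auto intro: ExistsI[where t = Star])
      then show "entails \<Sigma> ?\<Delta> ?\<Gamma>' Fls"
        by (rule ImplE[OF ConjE2[OF q(1)]])
    qed (use i in simp_all)
    ultimately show ?thesis
      by (rule DisjE)
  qed
  ultimately show ?thesis
    using i by (auto intro: ExistsE)
qed

theorem theorem5:
  fixes \<Sigma> :: "'c \<Rightarrow> 'b ty" and \<Delta> :: "'b ty list" and \<Gamma> :: "('b, 'c) tm set"
  assumes "\<And>T. entails \<Sigma> \<Delta> \<Gamma> (no_surjection T)"
  shows "entails \<Sigma> \<Delta> \<Gamma> excluded_middle"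
proof -
  \<comment> \<open>Since \<open>no_surjection One\<close> is closed, discharging it as a hypothesis carries it under the
    quantifier without a weakening theorem for derivations.\<close>
  have "\<up>(no_surjection One) = no_surjection One"
    by (simp add: no_surjection_def set_defs is_function_def kfinite_def Exists1_def)
  then have "no_surjection One \<in> up ` insert (no_surjection One) \<Gamma>"
    by (metis imageI insertI1)
  then have "entails \<Sigma> (Omega # \<Delta>) (up ` insert (no_surjection One) \<Gamma>) (no_surjection One)"
    by (intro hyp no_surjection_type)
  \<comment> \<open>Under the quantifier the truth value is \<open>Var 0\<close>, so
    \<open>excluded_middle_Var\<close> is used with index 0.\<close>
  then have "entails \<Sigma> \<Delta> (insert (no_surjection One) \<Gamma>) excluded_middle"
    unfolding excluded_middle_def by (intro ForallI excluded_middle_Var) simp_all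
  then have "entails \<Sigma> \<Delta> \<Gamma> (no_surjection One \<^bold>\<longrightarrow> excluded_middle)"
    by (intro ImplI no_surjection_type)
  then show ?thesis
    using assms by (rule ImplE)
qed

end
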